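(* Let $X$ be a compact ultrametric space. Then there exists a finite approximative sequence (FAS) $(\varepsilon_n,A_n)_{n\in\mathbb{N}}$ of $X$ such that its inverse limit $\mathcal{X}=\varprojlim\left(U_{2\varepsilon_n}(A_n),p_{n,n+1}\right)_{n\in\mathbb{N}}$ is homeomorphic to $X$.
   Context: An ultrametric space is a metric space $(X,\mathrm{d})$ with $\mathrm{d}(x,y)\leqslant\max\{\mathrm{d}(x,z),\mathrm{d}(y,z)\}$ for all $x,y,z\in X$. Let $(X,\mathrm{d})$ be a compact metric space and $\mathbb{N}=\{1,2,\ldots\}$. For $\varepsilon>0$, a finite $\varepsilon$-approximation of $X$ is a finite subset $A\subset X$ such that for every $x\in X$ there is $a\in A$ with $\mathrm{d}(x,a)<\varepsilon$. A finite approximative sequence (FAS) of $X$ is a pair of sequences $(\varepsilon_n,A_n)_{n\in\mathbb{N}}$, where $(\varepsilon_n)$ is a decreasing sequence of positive real numbers tending to $0$, each $A_n$ is a finite $\varepsilon_n$-approximation of $X$, and for every $n$, $\varepsilon_{n+1}<\frac{\varepsilon_n-\gamma_n}{2}$, where $\gamma_n=\sup\{\mathrm{d}(x,A_n):x\in X\}$ (which is $<\varepsilon_n$). For a FAS, $U_{2\varepsilon_n}(A_n)=\{C\subseteq A_n: C\neq\emptyset,\ \mathrm{diam}(C)<2\varepsilon_n\}$, with the upper semifinite topology: it is the finite $T_0$ space in which the minimal open neighborhood of $C$ is $\{D: \emptyset\neq D\subseteq C\}$ (so the open sets are exactly the sets closed under taking nonempty subsets). The bonding maps are the continuous maps $p_{n,n+1}:U_{2\varepsilon_{n+1}}(A_{n+1})\to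 U_{2\varepsilon_n}(A_n)$, $p_{n,n+1}(C)=\bigcup_{c\in C}\{a\in A_n:\mathrm{d}(a,c)=\mathrm{d}(A_n,c)\}$. The inverse limit is $\mathcal{X}=\{(C_n)_{n\in\mathbb{N}}\in\prod_n U_{2\varepsilon_n}(A_n): p_{n,n+1}(C_{n+1})=C_n\ \forall n\}$ with the subspace topology of the product topology. *)

theory Defs
  imports "HOL-Analysis.Analysis"
begin

definition ultrametric_on :: "'a::metric_space set \<Rightarrow> bool" where
  "ultrametric_on X \<longleftrightarrow> (\<forall>x\<in>X. \<forall>y\<in>X. \<forall>z\<in>X. dist x y \<le> max (dist x z) (dist y z))"

definition finite_approximation :: "'a::metric_space set \<Rightarrow> real \<Rightarrow> 'a set \<Rightarrow> bool" where
  "finite_approximation X e A \<longleftrightarrow> finite A \<and> A \<subseteq> X \<and> (\<forall>x\<in>X. \<exists>a\<in>A. dist x a < e)"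

text \<open>
  Since \<open>Sup {}\<close> is unspecified on the reals, the value for empty \<open>X\<close> is fixed to be 0, as for \<^const>\<open>infdist\<close> and \<^const>\<open>diameter\<close>.
\<close>

definition approx_gap :: "'a::metric_space set \<Rightarrow> 'a set \<Rightarrow> real" where
  "approx_gap X A = (if X = {} then 0 else SUP x\<in>X. infdist x A)"

text \<open>Sequences are indexed from 1; the values at 0 play no role.\<close>

definition finite_approximative_sequence ::
    "'a::metric_space set \<Rightarrow> (nat \<Rightarrow> real) \<Rightarrow> (nat \<Rightarrow> 'a set) \<Rightarrow> bool" where
  "finite_approximative_sequence X \<epsilon> A \<longleftrightarrow>
     strict_antimono_on {1..} \<epsilon> \<and> (\<forall>n\<ge>1. \<epsilon> n > 0) \<and> \<epsilon> \<longlonglongrightarrow> 0 \<and>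
     (\<forall>n\<ge>1. finite_approximation X (\<epsilon> n) (A n)) \<and>
     (\<forall>n\<ge>1. \<epsilon> (Suc n) < (\<epsilon> n - approx_gap X (A n)) / 2)"

definition small_subsets :: "real \<Rightarrow> 'a::metric_space set \<Rightarrow> 'a set set" where
  "small_subsets r A = {C. C \<subseteq> A \<and> C \<noteq> {} \<and> diameter C < r}"

definition upper_semifinite_topology :: "'a set set \<Rightarrow> 'a set topology" where
  "upper_semifinite_topology U =
     topology (\<lambda>W. W \<subseteq> U \<and> (\<forall>C\<in>W. \<forall>D\<in>U. D \<subseteq> C \<longrightarrow> D \<in> W))"

lemma openin_upper_semifinite_topology:
  "openin (upper_semifinite_topology U) W \<longleftrightarrow>
     W \<subseteq> U \<and> (\<forall>C\<in>W. \<forall>D\<in>U. D \<subseteq> C \<longrightarrow> D \<in> W)"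
proof -
  have "istopology (\<lambda>W. W \<subseteq> U \<and> (\<forall>C\<in>W. \<forall>D\<in>U. D \<subseteq> C \<longrightarrow> D \<in> W))"
    unfolding istopology_def by blast
  then show ?thesis
    by (simp add: upper_semifinite_topology_def topology_inverse')
qed

lemma topspace_upper_semifinite_topology: "topspace (upper_semifinite_topology U) = U"
  by (auto simp: topspace_def openin_upper_semifinite_topology)

lemma small_subsets_downward_closed:
  assumes "finite A" "C \<in> small_subsets r A" "D \<noteq> {}" "D \<subseteq> C"
  shows "D \<in> small_subsets r A"
proof -
  have "finite C"
    using assms finite_subset by (auto simp: small_subsets_def)
  then have "diameter D \<le> diameter C"
    using assms by (intro diameter_subset finite_imp_bounded)
  then show ?thesis
    using assms by (auto simp: small_subsets_def)
qed

text \<open>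
  Restricted to \<open>small_subsets (2 * \<epsilon> (Suc n)) (A (Suc n))\<close>, the map \<open>nearest_points (A n)\<close> is the
  bonding map of a finite approximative sequence; the condition on \<open>\<epsilon> (Suc n)\<close> makes it land in
  \<open>small_subsets (2 * \<epsilon> n) (A n)\<close>.
\<close>

definition nearest_points :: "'a::metric_space set \<Rightarrow> 'a set \<Rightarrow> 'a set" where
  "nearest_points A C = (\<Union>c\<in>C. {a \<in> A. dist a c = infdist c A})"

text \<open>Here \<open>p n\<close> is the bonding map from \<open>T (Suc n)\<close> to \<open>T n\<close>, for \<open>n \<ge> 1\<close>.\<close>

definition inverse_limit :: "(nat \<Rightarrow> 'a topology) \<Rightarrow> (nat \<Rightarrow> 'a \<Rightarrow> 'a) \<Rightarrow> (nat \<Rightarrow> 'a) topology" where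
  "inverse_limit T p =
     subtopology (product_topology T {1..})
       {c \<in> (\<Pi>\<^sub>E n\<in>{1..}. topspace (T n)). \<forall>n\<ge>1. p n (c (Suc n)) = c n}"

definition FAS_inverse_limit ::
    "(nat \<Rightarrow> real) \<Rightarrow> (nat \<Rightarrow> 'a::metric_space set) \<Rightarrow> (nat \<Rightarrow> 'a set) topology" where
  "FAS_inverse_limit \<epsilon> A =
     inverse_limit (\<lambda>n. upper_semifinite_topology (small_subsets (2 * \<epsilon> n) (A n)))
       (\<lambda>n. nearest_points (A n))"

end

theory Submission
  imports Defs
begin

text \<open>
  In an ultrametric space the open balls of a fixed radius \<open>e\<close> partition the space. Let \<open>A\<close> contain
  exactly one point of each ball; by compactness \<open>A\<close> is finite. Every point \<open>x\<close> then has a unique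
  nearest point in \<open>A\<close>, namely the representative of its ball, and a subset of \<open>X\<close> of diameter
  less than \<open>e\<close> lies inside one ball, so that all its points share this representative.

  Take a FAS whose approximations \<open>A n\<close> are such systems of representatives for the radii \<open>\<epsilon> n\<close>.
  The FAS inequality gives \<open>2 * \<epsilon> (Suc n) < \<epsilon> n\<close>, so every bonding map sends each small set
  to a singleton (\<open>nearest_points_small_eq_representative\<close>). Points of the inverse limit are
  images under bonding maps in every coordinate; hence they are sequences of singletons, that is,
  nested sequences of balls (\<open>inverse_limit_coordinates_singletons\<close>). Singletons are minimal, hence
  open, in the upper semifinite topology, so the inverse limit is Hausdorff
  (\<open>Hausdorff_FAS_inverse_limit\<close>). The map sending \<open>x\<close> to the sequence of its representatives
  is continuous because representatives are locally constant, injective because \<open>\<epsilon>\<close> tends to 0,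
  and surjective because a nested sequence of balls in a compact space has a common point
  (\<open>nested_balls_common_point\<close>). A continuous bijection from a compact space to a Hausdorff space
  is a homeomorphism.

  Such a FAS is built by recursion on the radius (\<open>transversal_FAS_exists\<close>). The continuous function \<open>\<lambda>x. infdist x (A n)\<close>
  attains its supremum on the compact space \<open>X\<close>, so \<open>\<epsilon> n - approx_gap X (A n)\<close> is positive and
  leaves room for the next radius.
\<close>

section \<open>Representatives of the balls of an ultrametric space\<close>

definition ball_transversal :: "'a::metric_space set \<Rightarrow> real \<Rightarrow> 'a set \<Rightarrow> bool" where
  "ball_transversal X e A \<longleftrightarrow> finite A \<and> A \<subseteq> X \<and> (\<forall>x\<in>X. \<exists>!a. a \<in> A \<and> dist x a < e)"

definition representative :: "real \<Rightarrow> 'a::metric_space set \<Rightarrow> 'a \<Rightarrow> 'a" where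
  "representative e A x = (THE a. a \<in> A \<and> dist x a < e)"

lemma ultrametric_less_trans:
  assumes "ultrametric_on X" "x \<in> X" "y \<in> X" "z \<in> X" "dist x y < e" "dist y z < e"
  shows "dist x z < e"
proof -
  have "dist x z \<le> max (dist x y) (dist z y)"
    using assms unfolding ultrametric_on_def by blast
  then show ?thesis
    using assms by (simp add: dist_commute)
qed

text \<open>
  A finite \<open>e\<close>-approximation of least cardinality works: of two of its points in the same ball,
  one could be dropped.
\<close>

lemma ball_transversal_exists:
  fixes X :: "'a::metric_space set"
  assumes "compact X" "ultrametric_on X" "e > 0"
  shows "\<exists>A. ball_transversal X e A"
proof -
  obtain K where K: "K \<subseteq> X" "finite K" "X \<subseteq> (\<Union>a\<in>K. ball a e)"
    using compactE_image[OF assms(1), of X "\<lambda>a. ball a e"] \<open>e > 0\<close>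
    by (metis (no_types, lifting) UN_iff centre_in_ball open_ball subsetI)
  have "finite_approximation X e K"
    using K by (auto simp: finite_approximation_def dist_commute subset_iff)
  then obtain A where A: "finite_approximation X e A"
      and least: "\<And>B. finite_approximation X e B \<Longrightarrow> card A \<le> card B"
    using ex_has_least_nat[of "finite_approximation X e" K card] by auto
  have "a = b"
    if x: "x \<in> X" and a: "a \<in> A" "dist x a < e" and b: "b \<in> A" "dist x b < e" for x a b
  proof (rule ccontr)
    assume "a \<noteq> b"
    have AX: "finite A" "A \<subseteq> X"
      using A by (auto simp: finite_approximation_def)
    have ba: "dist b a < e"
      using ultrametric_less_trans[OF assms(2), of b x a e] x a b AX by (auto simp: dist_commute)
    have "\<exists>c\<in>A - {b}. dist y c < e" if y: "y \<in> X" for y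
    proof -
      obtain c where c: "c \<in> A" "dist y c < e"
        using A y by (auto simp: finite_approximation_def)
      show ?thesis
      proof (cases "c = b")
        case True
        then have "dist y a < e"
          using ultrametric_less_trans[OF assms(2), of y b a e] y c a b ba AX by auto
        then show ?thesis
          using a \<open>a \<noteq> b\<close> by auto
      qed (use c in auto)
    qed
    then have "finite_approximation X e (A - {b})"
      using AX by (auto simp: finite_approximation_def)
    then have "card A \<le> card (A - {b})"
      by (rule least)
    moreover have "card (A - {b}) < card A"
      using AX b by (intro card_Diff1_less)
    ultimately show False
      by simp
  qed
  then have "\<exists>!a. a \<in> A \<and> dist x a < e" if "x \<in> X" for x
    using A that by (intro ex_ex1I) (auto simp: finite_approximation_def)
  then have "ball_transversal X e A"
    using A by (simp add: ball_transversal_def finite_approximation_def)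
  then show ?thesis ..
qed

lemma ball_transversal_imp_finite_approximation:
  "ball_transversal X e A \<Longrightarrow> finite_approximation X e A"
  unfolding ball_transversal_def finite_approximation_def by blast

lemma representative:
  assumes "ball_transversal X e A" "x \<in> X"
  shows "representative e A x \<in> A" "dist x (representative e A x) < e"
  using theI'[of "\<lambda>a. a \<in> A \<and> dist x a < e"] assms
  unfolding ball_transversal_def representative_def by auto

lemma representative_unique:
  assumes "ball_transversal X e A" "x \<in> X" "a \<in> A" "dist x a < e"
  shows "representative e A x = a"
  using assms representative[OF assms(1,2)] unfolding ball_transversal_def by blast

lemma representative_eq_of_close:
  assumes "ultrametric_on X" "ball_transversal X e A" "x \<in> X" "y \<in> X" "dist x y < e"
  shows "representative e A x = representative e A y"
proof -
  have "A \<subseteq> X"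
    using assms(2) by (simp add: ball_transversal_def)
  then have "dist x (representative e A y) < e"
    using ultrametric_less_trans[OF assms(1,3,4) _ assms(5)] representative[OF assms(2,4)] by blast
  then show ?thesis
    using representative_unique[OF assms(2,3)] representative[OF assms(2,4)] by blast
qed

text \<open>
  Every point of \<open>A\<close> other than the representative of \<open>x\<close> is at distance at least \<open>e\<close>
  from \<open>x\<close>, so it cannot be nearest.
\<close>

lemma nearest_points_eq_representative:
  assumes "ball_transversal X e A" "x \<in> X"
  shows "{a \<in> A. dist a x = infdist x A} = {representative e A x}"
proof -
  let ?r = "representative e A x"
  have r: "?r \<in> A" "dist x ?r < e"
    using representative[OF assms] by auto
  have fin: "finite A"
    using assms by (simp add: ball_transversal_def)
  have less: "infdist x A < e"
    using infdist_le[OF r(1), of x] r(2) by linarith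
  have "a = ?r" if "a \<in> A" "dist a x = infdist x A" for a
    using representative_unique[OF assms that(1)] that(2) less by (simp add: dist_commute)
  moreover have "\<exists>a\<in>A. infdist x A = dist x a"
  proof -
    have "A \<noteq> {}"
      using r(1) by blast
    then have "infdist x A = Min (dist x ` A)"
      using fin by (simp add: infdist_def cInf_eq_Min)
    moreover have "Min (dist x ` A) \<in> dist x ` A"
      using fin \<open>A \<noteq> {}\<close> by (intro Min_in) auto
    ultimately show ?thesis
      by auto
  qed
  ultimately show ?thesis
    by (auto simp: dist_commute)
qed

lemma nearest_points_small_eq_representative:
  assumes "ultrametric_on X" "ball_transversal X e A"
    and "x \<in> C" "C \<subseteq> X" "bounded C" "diameter C < e"
  shows "nearest_points A C = {representative e A x}"
proof -
  have "{a \<in> A. dist a y = infdist y A} = {representative e A x}" if "y \<in> C" for y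
  proof -
    have "dist y x < e"
      using diameter_bounded_bound[OF assms(5) that assms(3)] assms(6) by linarith
    then have "representative e A y = representative e A x"
      using representative_eq_of_close[OF assms(1,2)] that assms(3,4) by blast
    then show ?thesis
      using nearest_points_eq_representative[OF assms(2), of y] that assms(4) by auto
  qed
  then show ?thesis
    using assms(3) unfolding nearest_points_def by auto
qed

section \<open>Approximative sequences of ball representatives\<close>

lemma approx_gap_nonneg:
  assumes "compact X"
  shows "0 \<le> approx_gap X A"
proof (cases "X = {}")
  case False
  then obtain x where "x \<in> X"
    by blast
  moreover have "bdd_above ((\<lambda>x. infdist x A) ` X)"
    by (intro bounded_imp_bdd_above compact_imp_bounded compact_continuous_image
          continuous_intros assms)
  ultimately have "infdist x A \<le> (SUP x\<in>X. infdist x A)"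
    by (rule cSUP_upper)
  then show ?thesis
    using False infdist_nonneg[of x A] by (simp add: approx_gap_def)
qed (simp add: approx_gap_def)

text \<open>The bound is strict because the supremum is attained on a compact space.\<close>

lemma approx_gap_less:
  assumes "compact X" "finite_approximation X e A" "e > 0"
  shows "approx_gap X A < e"
proof (cases "X = {}")
  case False
  have "continuous_on X (\<lambda>x. infdist x A)"
    by (intro continuous_intros)
  then obtain x where x: "x \<in> X" "\<And>y. y \<in> X \<Longrightarrow> infdist y A \<le> infdist x A"
    using continuous_attains_sup[OF assms(1) False] by blast
  obtain a where "a \<in> A" "dist x a < e"
    using assms(2) x(1) by (auto simp: finite_approximation_def)
  then have "infdist x A < e"
    using infdist_le[of a A x] by linarith
  moreover have "(SUP x\<in>X. infdist x A) \<le> infdist x A"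
    using False x(2) by (rule cSUP_least)
  ultimately show ?thesis
    using False by (simp add: approx_gap_def)
qed (use assms in \<open>simp add: approx_gap_def\<close>)

lemma FAS_radius_halving:
  assumes "compact X" "finite_approximative_sequence X \<epsilon> A" "n \<ge> 1"
  shows "2 * \<epsilon> (Suc n) < \<epsilon> n"
proof -
  have "\<epsilon> (Suc n) < (\<epsilon> n - approx_gap X (A n)) / 2"
    using assms by (simp add: finite_approximative_sequence_def)
  then show ?thesis
    using approx_gap_nonneg[OF assms(1), of "A n"] by argo
qed

text \<open>
  Taking a third of \<open>\<epsilon> n - approx_gap X (A n)\<close> as the next radius satisfies the strict FAS inequality
  and bounds the radii by a geometric sequence, which forces them to 0.
\<close>

lemma transversal_FAS_exists:
  fixes X :: "'a::metric_space set"
  assumes "compact X" "ultrametric_on X"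
  shows "\<exists>\<epsilon> A. finite_approximative_sequence X \<epsilon> A \<and> (\<forall>n. ball_transversal X (\<epsilon> n) (A n))"
proof -
  obtain N where N: "\<And>e. e > 0 \<Longrightarrow> ball_transversal X e (N e)"
    using ball_transversal_exists[OF assms] by metis
  define \<epsilon> where "\<epsilon> = rec_nat 1 (\<lambda>_ e. (e - approx_gap X (N e)) / 3)"
  have \<epsilon>_0: "\<epsilon> 0 = 1" and \<epsilon>_Suc: "\<epsilon> (Suc n) = (\<epsilon> n - approx_gap X (N (\<epsilon> n))) / 3" for n
    by (simp_all add: \<epsilon>_def)
  define A where "A = (\<lambda>n. N (\<epsilon> n))"
  have gap: "approx_gap X (N e) < e" if "e > 0" for e
    using approx_gap_less[OF assms(1)] ball_transversal_imp_finite_approximation[OF N] that by blast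
  have pos: "\<epsilon> n > 0" for n
    by (induction n) (use gap in \<open>simp_all add: \<epsilon>_0 \<epsilon>_Suc\<close>)
  have transversal: "ball_transversal X (\<epsilon> n) (A n)" for n
    using N[OF pos] by (simp add: A_def)
  have third: "\<epsilon> (Suc n) \<le> \<epsilon> n / 3" for n
    using approx_gap_nonneg[OF assms(1), of "N (\<epsilon> n)"] by (simp add: \<epsilon>_Suc)
  have "- \<epsilon> n < - \<epsilon> (Suc n)" for n
    using third[of n] pos[of n] by linarith
  then have "- \<epsilon> m < - \<epsilon> n" if "m < n" for m n
    using lift_Suc_mono_less[of "\<lambda>n. - \<epsilon> n" m n] that by blast
  then have "strict_antimono_on {1..} \<epsilon>"
    by (intro monotone_onI) simp
  moreover have "\<epsilon> \<longlonglongrightarrow> 0"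
  proof (rule tendsto_sandwich[of "\<lambda>_. 0" _ _ "\<lambda>n. (1/3) ^ n"])
    have "\<epsilon> n \<le> (1/3) ^ n" for n
    proof (induction n)
      case (Suc n)
      then show ?case
        using third[of n] by simp
    qed (simp add: \<epsilon>_0)
    then show "\<forall>\<^sub>F n in sequentially. \<epsilon> n \<le> (1/3) ^ n"
      by simp
    show "(\<lambda>n. (1/3) ^ n :: real) \<longlonglongrightarrow> 0"
      by (rule LIMSEQ_power_zero) simp
  qed (use pos in \<open>simp_all add: less_imp_le\<close>)
  moreover have "\<epsilon> (Suc n) < (\<epsilon> n - approx_gap X (A n)) / 2" for n
  proof -
    have "0 < \<epsilon> n - approx_gap X (A n)"
      using gap[OF pos, of n] by (simp add: A_def)
    then have "(\<epsilon> n - approx_gap X (A n)) / 3 < (\<epsilon> n - approx_gap X (A n)) / 2"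
      by (intro divide_strict_left_mono) auto
    then show ?thesis
      by (simp add: \<epsilon>_Suc A_def)
  qed
  ultimately have "finite_approximative_sequence X \<epsilon> A"
    using pos ball_transversal_imp_finite_approximation[OF transversal]
    by (simp add: finite_approximative_sequence_def)
  then show ?thesis
    using transversal by blast
qed

section \<open>The inverse limit\<close>

lemma topspace_FAS_inverse_limit:
  "topspace (FAS_inverse_limit \<epsilon> A) =
     {c \<in> (\<Pi>\<^sub>E n\<in>{1..}. small_subsets (2 * \<epsilon> n) (A n)).
        \<forall>n\<ge>1. nearest_points (A n) (c (Suc n)) = c n}"
  by (auto simp: FAS_inverse_limit_def inverse_limit_def topspace_upper_semifinite_topology)

text \<open>
  The coordinate \<open>c n\<close> is the image of \<open>c (Suc n)\<close>, whose diameter is below \<open>\<epsilon> n\<close>;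
  hence it is a singleton, and consecutive coordinates lie in a common ball of radius \<open>\<epsilon> n\<close>.
\<close>

lemma inverse_limit_coordinates_singletons:
  assumes "compact X" "ultrametric_on X"
    and FAS: "finite_approximative_sequence X \<epsilon> A"
    and transversal: "\<And>n. n \<ge> 1 \<Longrightarrow> ball_transversal X (\<epsilon> n) (A n)"
    and c: "c \<in> topspace (FAS_inverse_limit \<epsilon> A)"
  obtains a where "\<And>n. n \<ge> 1 \<Longrightarrow> c n = {a n}" "\<And>n. n \<ge> 1 \<Longrightarrow> a n \<in> A n"
    "\<And>n. n \<ge> 1 \<Longrightarrow> dist (a (Suc n)) (a n) < \<epsilon> n"
proof -
  have small: "c n \<in> small_subsets (2 * \<epsilon> n) (A n)" if "n \<ge> 1" for n
    using c that by (auto simp: topspace_FAS_inverse_limit PiE_iff)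
  have AX: "finite (A n)" "A n \<subseteq> X" if "n \<ge> 1" for n
    using transversal[OF that] by (auto simp: ball_transversal_def)
  have coordinate: "c n = {representative (\<epsilon> n) (A n) x}"
    if n: "n \<ge> 1" and x: "x \<in> c (Suc n)" for n x
  proof -
    have sub: "c (Suc n) \<subseteq> A (Suc n)" and "diameter (c (Suc n)) < 2 * \<epsilon> (Suc n)"
      using small[of "Suc n"] by (auto simp: small_subsets_def)
    then have diam: "diameter (c (Suc n)) < \<epsilon> n"
      using FAS_radius_halving[OF assms(1) FAS n] by linarith
    have "c (Suc n) \<subseteq> X" "bounded (c (Suc n))"
      using sub AX[of "Suc n"] by (auto intro: finite_imp_bounded finite_subset)
    then have "nearest_points (A n) (c (Suc n)) = {representative (\<epsilon> n) (A n) x}"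
      using nearest_points_small_eq_representative[OF assms(2) transversal[OF n] x] diam by blast
    then show ?thesis
      using c n by (simp add: topspace_FAS_inverse_limit)
  qed
  have nonempty: "c n \<noteq> {}" if "n \<ge> 1" for n
    using small[OF that] by (simp add: small_subsets_def)
  define a where "a = (\<lambda>n. the_elem (c n))"
  have single: "c n = {a n}" if n: "n \<ge> 1" for n
  proof -
    obtain x where "x \<in> c (Suc n)"
      using nonempty[of "Suc n"] by auto
    from coordinate[OF n this] show ?thesis
      by (simp add: a_def)
  qed
  moreover have aA: "a n \<in> A n" if "n \<ge> 1" for n
    using small[OF that] single[OF that] by (auto simp: small_subsets_def)
  moreover have "dist (a (Suc n)) (a n) < \<epsilon> n" if n: "n \<ge> 1" for n
  proof -
    have "a (Suc n) \<in> X"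
      using aA[of "Suc n"] AX[of "Suc n"] by auto
    moreover have "a n = representative (\<epsilon> n) (A n) (a (Suc n))"
      using coordinate[OF n, of "a (Suc n)"] single[OF n] single[of "Suc n"] by simp
    ultimately show ?thesis
      using representative(2)[OF transversal[OF n]] by simp
  qed
  ultimately show ?thesis
    using that by blast
qed

text \<open>
  The strong triangle inequality keeps the whole tail of the sequence in the ball of radius \<open>\<epsilon> n\<close>
  around \<open>a n\<close>. The limit of a convergent subsequence stays in that ball as well, since open
  balls of an ultrametric space are closed.
\<close>

lemma nested_balls_common_point:
  fixes X :: "'a::metric_space set"
  assumes "compact X" "ultrametric_on X"
    and aX: "\<And>n. n \<ge> 1 \<Longrightarrow> a n \<in> X"
    and close: "\<And>n. n \<ge> 1 \<Longrightarrow> dist (a (Suc n)) (a n) < \<epsilon> n"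
    and decreasing: "strict_antimono_on {1..} \<epsilon>"
    and pos: "\<And>n. n \<ge> 1 \<Longrightarrow> (\<epsilon> n :: real) > 0"
  obtains x where "x \<in> X" "\<And>n. n \<ge> 1 \<Longrightarrow> dist x (a n) < \<epsilon> n"
proof -
  have tail: "dist (a m) (a n) < \<epsilon> n" if "1 \<le> n" "n \<le> m" for m n
    using that(2)
  proof (induction m rule: dec_induct)
    case base
    then show ?case
      using pos that by simp
  next
    case (step m)
    have "\<epsilon> m \<le> \<epsilon> n"
      using monotone_onD[OF decreasing, of n m] step that by (cases "n = m") auto
    then have "dist (a (Suc m)) (a m) < \<epsilon> n"
      using close[of m] step that by linarith
    then show ?case
      using ultrametric_less_trans[OF assms(2), of "a (Suc m)" "a m" "a n"] step that aX by auto
  qed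
  have "\<forall>n. a (Suc n) \<in> X"
    using aX by simp
  then obtain x s where x: "x \<in> X" and s: "strict_mono s" and lim: "((\<lambda>n. a (Suc n)) \<circ> s) \<longlonglongrightarrow> x"
    using assms(1) unfolding compact_def by meson
  have "dist x (a n) < \<epsilon> n" if n: "n \<ge> 1" for n
  proof -
    have "\<forall>\<^sub>F k in sequentially. dist (((\<lambda>n. a (Suc n)) \<circ> s) k) x < \<epsilon> n"
      using tendstoD[OF lim pos[OF n]] .
    then obtain k where k: "k \<ge> n" "dist (a (Suc (s k))) x < \<epsilon> n"
      by (auto simp: eventually_sequentially) (metis linorder_linear)
    have "n \<le> Suc (s k)"
      using seq_suble[OF s, of k] k(1) by linarith
    then have "dist (a (Suc (s k))) (a n) < \<epsilon> n"
      using tail n by blast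
    then show ?thesis
      using ultrametric_less_trans[OF assms(2), of x "a (Suc (s k))" "a n"] k(2) x aX n
      by (simp add: dist_commute)
  qed
  with x that show ?thesis
    by blast
qed

lemma openin_upper_semifinite_singleton:
  assumes "{a} \<in> U" "{} \<notin> U"
  shows "openin (upper_semifinite_topology U) {{a}}"
  using assms by (auto simp: openin_upper_semifinite_topology subset_singleton_iff)

text \<open>
  At a coordinate where two points differ, their values are distinct open singletons of the finite
  space; the preimages under the projection separate the points.
\<close>

lemma Hausdorff_FAS_inverse_limit:
  assumes "\<And>c n. c \<in> topspace (FAS_inverse_limit \<epsilon> A) \<Longrightarrow> n \<ge> 1 \<Longrightarrow> \<exists>a. c n = {a}"
  shows "Hausdorff_space (FAS_inverse_limit \<epsilon> A)"
  unfolding Hausdorff_space_def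
proof (intro allI impI, elim conjE)
  let ?L = "FAS_inverse_limit \<epsilon> A"
  let ?T = "\<lambda>n. upper_semifinite_topology (small_subsets (2 * \<epsilon> n) (A n))"
  fix c d
  assume c: "c \<in> topspace ?L" and d: "d \<in> topspace ?L" and "c \<noteq> d"
  have "c \<in> extensional {1..}" "d \<in> extensional {1..}"
    using c d by (auto simp: topspace_FAS_inverse_limit PiE_iff)
  then obtain n where n: "n \<ge> 1" "c n \<noteq> d n"
    using \<open>c \<noteq> d\<close> by (metis atLeast_iff extensionalityI)
  have proj: "continuous_map ?L (?T n) (\<lambda>b. b n)"
    unfolding FAS_inverse_limit_def inverse_limit_def
    using n by (intro continuous_map_from_subtopology continuous_map_product_projection) simp
  have "openin ?L {b \<in> topspace ?L. b n \<in> {e n}}" if e: "e \<in> topspace ?L" for e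
  proof -
    obtain a where a: "e n = {a}"
      using assms[OF e n(1)] by blast
    moreover have "e n \<in> small_subsets (2 * \<epsilon> n) (A n)"
      using e n by (auto simp: topspace_FAS_inverse_limit PiE_iff)
    ultimately have "openin (?T n) {e n}"
      by (metis (mono_tags, lifting) openin_upper_semifinite_singleton small_subsets_def mem_Collect_eq)
    then show ?thesis
      by (rule openin_continuous_map_preimage[OF proj])
  qed
  moreover have "disjnt {b \<in> topspace ?L. b n \<in> {c n}} {b \<in> topspace ?L. b n \<in> {d n}}"
    using n by (auto simp: disjnt_def)
  ultimately show "\<exists>U V. openin ?L U \<and> openin ?L V \<and> c \<in> U \<and> d \<in> V \<and> disjnt U V"
    using c d by blast
qed

lemma transversal_FAS_inverse_limit_homeomorphic:
  fixes X :: "'a::metric_space set"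
  assumes "compact X" "ultrametric_on X"
    and FAS: "finite_approximative_sequence X \<epsilon> A"
    and transversal: "\<And>n. n \<ge> 1 \<Longrightarrow> ball_transversal X (\<epsilon> n) (A n)"
  shows "FAS_inverse_limit \<epsilon> A homeomorphic_space top_of_set X"
proof -
  let ?L = "FAS_inverse_limit \<epsilon> A"
  let ?T = "\<lambda>n. upper_semifinite_topology (small_subsets (2 * \<epsilon> n) (A n))"
  let ?r = "\<lambda>n x. representative (\<epsilon> n) (A n) x"
  define f where "f = (\<lambda>x. \<lambda>n\<in>{1..}. {?r n x})"
  have pos: "\<epsilon> n > 0" if "n \<ge> 1" for n
    using FAS that by (simp add: finite_approximative_sequence_def)
  have AX: "A n \<subseteq> X" if "n \<ge> 1" for n
    using transversal[OF that] by (simp add: ball_transversal_def)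
  have singleton_small: "{?r n x} \<in> small_subsets (2 * \<epsilon> n) (A n)" if "n \<ge> 1" "x \<in> X" for n x
    using representative(1)[OF transversal] pos that by (auto simp: small_subsets_def)
  have into: "f x \<in> topspace ?L" if x: "x \<in> X" for x
  proof -
    have "nearest_points (A n) {?r (Suc n) x} = {?r n x}" if n: "n \<ge> 1" for n
    proof -
      have y: "?r (Suc n) x \<in> X" "dist x (?r (Suc n) x) < \<epsilon> (Suc n)"
        using representative[OF transversal[of "Suc n"] x] AX[of "Suc n"] by auto
      have "\<epsilon> (Suc n) < \<epsilon> n"
        using FAS_radius_halving[OF assms(1) FAS n] pos[of "Suc n"] by simp
      then have "?r n (?r (Suc n) x) = ?r n x"
        using representative_eq_of_close[OF assms(2) transversal[OF n] x y(1)] y(2) by simp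
      then show ?thesis
        using nearest_points_eq_representative[OF transversal[OF n] y(1)]
        by (simp add: nearest_points_def)
    qed
    then show ?thesis
      using x by (auto simp: topspace_FAS_inverse_limit f_def singleton_small)
  qed
  have "continuous_map (top_of_set X) ?L f"
  proof -
    have coordinate: "continuous_map (top_of_set X) (?T n) (\<lambda>x. {?r n x})" if n: "n \<ge> 1" for n
    proof -
      have "openin (top_of_set X) {x \<in> X. {?r n x} \<in> U}" for U
      proof (subst openin_euclidean_subtopology_iff, intro conjI ballI)
        fix x
        assume x: "x \<in> {x \<in> X. {?r n x} \<in> U}"
        have "y \<in> {x \<in> X. {?r n x} \<in> U}" if "y \<in> X" "dist y x < \<epsilon> n" for y
          using representative_eq_of_close[OF assms(2) transversal[OF n] that(1) _ that(2)] x that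
          by auto
        then show "\<exists>e>0. \<forall>y\<in>X. dist y x < e \<longrightarrow> y \<in> {x \<in> X. {?r n x} \<in> U}"
          using pos[OF n] by blast
      qed auto
      then show "continuous_map (top_of_set X) (?T n) (\<lambda>x. {?r n x})"
        using singleton_small[OF n]
        by (auto simp: continuous_map_def topspace_upper_semifinite_topology)
    qed
    have "continuous_map (top_of_set X) (product_topology ?T {1..}) f"
      unfolding continuous_map_componentwise using coordinate
      by (auto simp: f_def)
    then show ?thesis
      using into unfolding FAS_inverse_limit_def inverse_limit_def
      by (auto simp: continuous_map_in_subtopology)
  qed
  moreover have "f ` X = topspace ?L"
  proof (intro equalityI subsetI)
    fix c
    assume c: "c \<in> topspace ?L"
    obtain a where a: "\<And>n. n \<ge> 1 \<Longrightarrow> c n = {a n}" "\<And>n. n \<ge> 1 \<Longrightarrow> a n \<in> A n"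
        "\<And>n. n \<ge> 1 \<Longrightarrow> dist (a (Suc n)) (a n) < \<epsilon> n"
      using inverse_limit_coordinates_singletons[OF assms(1,2) FAS transversal c] by blast
    have "a n \<in> X" if "n \<ge> 1" for n
      using a(2)[OF that] AX[OF that] by blast
    moreover have "strict_antimono_on {1..} \<epsilon>"
      using FAS by (simp add: finite_approximative_sequence_def)
    ultimately obtain x where x: "x \<in> X" "\<And>n. n \<ge> 1 \<Longrightarrow> dist x (a n) < \<epsilon> n"
      using nested_balls_common_point[OF assms(1,2), of a \<epsilon>] a(3) pos by blast
    have "c = f x"
    proof (rule extensionalityI)
      show "c \<in> extensional {1..}"
        using c by (auto simp: topspace_FAS_inverse_limit PiE_iff)
      show "f x \<in> extensional {1..}"
        by (simp add: f_def)
      show "c n = f x n" if "n \<in> {1..}" for n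
        using representative_unique[OF transversal x(1) a(2) x(2), of n] a(1)[of n] that
        by (simp add: f_def)
    qed
    then show "c \<in> f ` X"
      using x(1) by blast
  qed (use into in auto)
  moreover have "inj_on f X"
  proof (rule inj_onI, rule ccontr)
    fix x y
    assume x: "x \<in> X" and y: "y \<in> X" and eq: "f x = f y" and "x \<noteq> y"
    have "\<epsilon> \<longlonglongrightarrow> 0"
      using FAS by (simp add: finite_approximative_sequence_def)
    then have "\<forall>\<^sub>F n in sequentially. n \<ge> 1 \<and> \<epsilon> n < dist x y / 2"
      using \<open>x \<noteq> y\<close> by (intro eventually_conj eventually_ge_at_top order_tendstoD(2)) auto
    then obtain n where n: "n \<ge> 1" "\<epsilon> n < dist x y / 2"
      using eventually_happens'[OF sequentially_bot] by blast
    have "?r n x = ?r n y"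
      using fun_cong[OF eq, of n] n by (simp add: f_def)
    then have "dist x y < \<epsilon> n + \<epsilon> n"
      using representative(2)[OF transversal[OF n(1)] x] representative(2)[OF transversal[OF n(1)] y]
        dist_triangle2[of x y "?r n x"] by simp
    with n show False
      by simp
  qed
  moreover have "Hausdorff_space ?L"
    using inverse_limit_coordinates_singletons[OF assms(1,2) FAS transversal]
    by (intro Hausdorff_FAS_inverse_limit) metis
  ultimately have "homeomorphic_map (top_of_set X) ?L f"
    using assms(1) by (intro continuous_imp_homeomorphic_map) (auto simp: compact_space_subtopology)
  then show ?thesis
    using homeomorphic_map_imp_homeomorphic_space homeomorphic_space_sym by blast
qed

theorem theorem4:
  fixes X :: "'a::metric_space set"
  assumes "compact X" and "ultrametric_on X"
  shows "\<exists>\<epsilon> A. finite_approximative_sequence X \<epsilon> A \<and>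
           FAS_inverse_limit \<epsilon> A homeomorphic_space top_of_set X"
  using transversal_FAS_exists[OF assms] transversal_FAS_inverse_limit_homeomorphic[OF assms] by blast

end
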